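(* Let $\mathcal{H}_1,\mathcal{H}_2,\mathcal{K}_1,\mathcal{K}_2$ be closed subspaces of $L^2$, let $\phi,\psi\in L^\infty$, and let $a_1 \in \mathscr{G}L^\infty$ with $a_1\mathcal{K}_1 = \mathcal{H}_1$. Suppose that $$\ker T_\phi^{\mathcal{K}_1,\mathcal{K}_2} = a_1^{-1} \ker T_\psi^{\mathcal{H}_1,\mathcal{H}_2}.$$ Then for any $a_2 \in \mathscr{G}L^\infty$ with $a_2 \mathcal{K}_2 = \mathcal{H}_2$, the function $\widetilde\phi = \bar a_2 \psi a_1 \in L^\infty$ satisfies $$\ker T_\phi^{\mathcal{K}_1,\mathcal{K}_2} = \ker T_{\widetilde\phi}^{\mathcal{K}_1,\mathcal{K}_2}.$$
   Context: $L^2 = L^2(\mathbb{T}, m)$, with $m$ normalized Lebesgue measure on the unit circle $\mathbb{T}$, and $L^\infty = L^\infty(\mathbb{T},m)$ (complex-valued functions). $\mathscr{G}L^\infty = \{g \in L^\infty : 1/g \in L^\infty\}$. For $g\in L^\infty$ and a subspace $\mathcal{M}$, $g\mathcal{M} = \{gf: f \in \mathcal{M}\}$. $P_{\mathcal{N}}$ is the orthogonal projection of $L^2$ onto the closed subspace $\mathcal{N}$. For closed subspaces $\mathcal{M}, \mathcal{N}$ of $L^2$ and $\phi \in L^\infty$, the generalized Toeplitz operator is $T_\phi^{\mathcal{M},\mathcal{N}} : \mathcal{M} \to \mathcal{N}$, $T_\phi^{\mathcal{M},\mathcal{N}} f = P_{\mathcal{N}}(\phi f)$. *)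

theory Defs
  imports "HOL-Analysis.Analysis"
begin

text \<open>
  Normalized Lebesgue measure on the unit circle: the completed image of Lebesgue measure on
  \<open>[0,1]\<close> under \<open>t \<mapsto> exp (2 \<pi> i t)\<close>.
\<close>

definition circle_measure :: "complex measure" where
  "circle_measure =
     completion (distr (restrict_space lborel {0..1}) (restrict_space borel (sphere 0 1))
                  (\<lambda>t. cis (2 * pi * t)))"

lemma space_circle_measure [simp]: "space circle_measure = sphere 0 1"
  by (simp add: circle_measure_def space_restrict_space)

lemma emeasure_space_circle_measure: "emeasure circle_measure (sphere 0 1) = 1"
proof -
  let ?N = "restrict_space borel (sphere 0 1) :: complex measure"
  have meas: "(\<lambda>t. cis (2 * pi * t)) \<in> restrict_space lborel {0..1} \<rightarrow>\<^sub>M ?N"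
    by (intro measurable_restrict_space2 measurable_restrict_space1)
       (auto intro!: borel_measurable_continuous_onI continuous_intros)
  have "sphere 0 1 \<in> sets ?N"
    using sets.top[of ?N] by (simp add: space_restrict_space)
  moreover have "(\<lambda>t. cis (2 * pi * t)) -` sphere 0 1 \<inter> {0..1::real} = {0..1}"
    by auto
  ultimately show ?thesis
    using meas
    by (simp add: circle_measure_def emeasure_distr space_restrict_space emeasure_restrict_space)
qed

text \<open>
  Complex measurable functions on the circle modulo equality almost everywhere, with pointwise
  operations. \<open>L\<^sup>2\<close> and \<open>L\<^sup>\<infinity>\<close> are subsets of this ring, so that products such as \<open>\<phi> f\<close> with
  \<open>\<phi> \<in> L\<^sup>\<infinity>\<close> and \<open>f \<in> L\<^sup>2\<close> are ring products.
\<close>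

quotient_type circle_fun = "complex \<Rightarrow> complex" / partial:
  "\<lambda>f g. f \<in> borel_measurable circle_measure \<and> g \<in> borel_measurable circle_measure \<and>
         (AE z in circle_measure. f z = g z)"
proof (rule part_equivpI)
  show "\<exists>f. f \<in> borel_measurable circle_measure \<and> f \<in> borel_measurable circle_measure \<and>
            (AE z in circle_measure. f z = (f z :: complex))"
    by (rule exI[of _ "\<lambda>_. 0"]) simp
  show "symp (\<lambda>f g. f \<in> borel_measurable circle_measure \<and>
                    g \<in> borel_measurable circle_measure \<and>
                    (AE z in circle_measure. f z = (g z :: complex)))"
    by (intro sympI) auto
  show "transp (\<lambda>f g. f \<in> borel_measurable circle_measure \<and>
                      g \<in> borel_measurable circle_measure \<and>
                      (AE z in circle_measure. f z = (g z :: complex)))"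
  proof (intro transpI, elim conjE, intro conjI)
    fix f g h :: "complex \<Rightarrow> complex"
    assume "AE z in circle_measure. f z = g z" "AE z in circle_measure. g z = h z"
    then show "AE z in circle_measure. f z = h z" by eventually_elim simp
  qed auto
qed

text \<open>The inverse is pointwise, with \<open>1 / 0 = 0\<close>.\<close>

instantiation circle_fun :: "{comm_ring_1, inverse}"
begin

lift_definition zero_circle_fun :: circle_fun is "\<lambda>_. 0" by simp

lift_definition one_circle_fun :: circle_fun is "\<lambda>_. 1" by simp

lift_definition plus_circle_fun :: "circle_fun \<Rightarrow> circle_fun \<Rightarrow> circle_fun"
  is "\<lambda>f g z. f z + g z"
  by auto

lift_definition minus_circle_fun :: "circle_fun \<Rightarrow> circle_fun \<Rightarrow> circle_fun"
  is "\<lambda>f g z. f z - g z"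
  by auto

lift_definition uminus_circle_fun :: "circle_fun \<Rightarrow> circle_fun"
  is "\<lambda>f z. - f z"
  by auto

lift_definition times_circle_fun :: "circle_fun \<Rightarrow> circle_fun \<Rightarrow> circle_fun"
  is "\<lambda>f g z. f z * g z"
  by auto

lift_definition inverse_circle_fun :: "circle_fun \<Rightarrow> circle_fun"
  is "\<lambda>f z. inverse (f z)"
  by auto

lift_definition divide_circle_fun :: "circle_fun \<Rightarrow> circle_fun \<Rightarrow> circle_fun"
  is "\<lambda>f g z. f z / g z"
  by auto

instance
proof
  show "(0::circle_fun) \<noteq> 1"
  proof (transfer, intro notI, elim conjE)
    assume "AE z in circle_measure. (0::complex) = 1"
    then have "AE z in circle_measure. False" by simp
    then have "emeasure circle_measure (space circle_measure) = 0"
      by (subst (asm) AE_iff_measurable[OF sets.top]) auto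
    then show False using emeasure_space_circle_measure by simp
  qed
qed (transfer; auto simp: algebra_simps)+

end

lemma borel_measurable_cnj [measurable (raw)]:
  "f \<in> borel_measurable M \<Longrightarrow> (\<lambda>z. cnj (f z)) \<in> borel_measurable M"
  by (rule measurable_compose[OF _ borel_measurable_continuous_onI]) (auto intro: continuous_on_cnj)

lift_definition cnj_fun :: "circle_fun \<Rightarrow> circle_fun" is "\<lambda>f z. cnj (f z)"
  by auto

lift_definition scaleC_fun :: "complex \<Rightarrow> circle_fun \<Rightarrow> circle_fun" is "\<lambda>c f z. c * f z"
  by auto

global_interpretation circle_fun: vector_space scaleC_fun
  defines csubspace = circle_fun.subspace
  by unfold_locales (transfer; auto simp: algebra_simps)+

lift_definition square_integrable :: "circle_fun \<Rightarrow> bool"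
  is "\<lambda>f. integrable circle_measure (\<lambda>z. (cmod (f z))\<^sup>2)"
  by (intro integrable_cong_AE) auto

lift_definition essentially_bounded :: "circle_fun \<Rightarrow> bool"
  is "\<lambda>f. \<exists>C::real. AE z in circle_measure. cmod (f z) \<le> C"
proof -
  have "\<exists>C::real. AE z in circle_measure. cmod (g z) \<le> C"
    if "AE z in circle_measure. f z = g z" "\<exists>C::real. AE z in circle_measure. cmod (f z) \<le> C"
    for f g :: "complex \<Rightarrow> complex"
  proof -
    from that obtain C where "AE z in circle_measure. cmod (f z) \<le> C" by auto
    with that(1) have "AE z in circle_measure. cmod (g z) \<le> C" by eventually_elim simp
    then show ?thesis by blast
  qed
  moreover fix f g :: "complex \<Rightarrow> complex"
  assume "f \<in> borel_measurable circle_measure \<and> g \<in> borel_measurable circle_measure \<and>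
          (AE z in circle_measure. f z = g z)"
  then have "AE z in circle_measure. f z = g z" "AE z in circle_measure. g z = f z"
    by auto
  ultimately show "(\<exists>C::real. AE z in circle_measure. cmod (f z) \<le> C) \<longleftrightarrow>
                   (\<exists>C::real. AE z in circle_measure. cmod (g z) \<le> C)"
    by blast
qed

lift_definition nonzero_AE :: "circle_fun \<Rightarrow> bool"
  is "\<lambda>f. AE z in circle_measure. f z \<noteq> 0"
  by auto

definition L2 :: "circle_fun set" where
  "L2 = {f. square_integrable f}"

definition Linf :: "circle_fun set" where
  "Linf = {f. essentially_bounded f}"

text \<open>
  Since \<open>1 / 0 = 0\<close>, the requirement that \<open>1/g\<close> be defined almost everywhere has to be stated
  separately.
\<close>

definition GLinf :: "circle_fun set" where
  "GLinf = {g \<in> Linf. nonzero_AE g \<and> 1 / g \<in> Linf}"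

text \<open>The following two are only meaningful for elements of \<open>L\<^sup>2\<close>.\<close>

lift_definition L2_inner :: "circle_fun \<Rightarrow> circle_fun \<Rightarrow> complex"
  is "\<lambda>f g. LINT z|circle_measure. f z * cnj (g z)"
  by (intro integral_cong_AE) auto

lift_definition L2_norm :: "circle_fun \<Rightarrow> real"
  is "\<lambda>f. sqrt (LINT z|circle_measure. (cmod (f z))\<^sup>2)"
  by (intro arg_cong[of _ _ sqrt] integral_cong_AE) auto

lemma L2_norm_nonneg [simp]: "0 \<le> L2_norm f"
  by transfer simp

lemma L2_norm_minus_commute: "L2_norm (f - g) = L2_norm (g - f)"
  by transfer (simp add: norm_minus_commute)

lemma norm_add_square_le:
  fixes a b :: "'a::real_normed_vector" and t :: real
  assumes "t > 0"
  shows "(norm (a + b))\<^sup>2 \<le> (1 + t) * (norm a)\<^sup>2 + (1 + 1 / t) * (norm b)\<^sup>2"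
proof -
  have "0 \<le> (t * norm a - norm b)\<^sup>2 / t" using assms by simp
  also have "\<dots> = t * (norm a)\<^sup>2 + (1 / t) * (norm b)\<^sup>2 - 2 * norm a * norm b"
    using assms by (simp add: field_simps power2_eq_square)
  finally have "(norm a + norm b)\<^sup>2 \<le> (1 + t) * (norm a)\<^sup>2 + (1 + 1 / t) * (norm b)\<^sup>2"
    by (simp add: algebra_simps power2_eq_square)
  moreover have "(norm (a + b))\<^sup>2 \<le> (norm a + norm b)\<^sup>2"
    by (intro power_mono norm_triangle_ineq) simp
  ultimately show ?thesis by linarith
qed

lemma L2_add:
  assumes "f \<in> L2" "g \<in> L2"
  shows "f + g \<in> L2"
  using assms unfolding L2_def mem_Collect_eq
proof transfer
  fix f g :: "complex \<Rightarrow> complex"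
  assume *: "f \<in> borel_measurable circle_measure \<and> f \<in> borel_measurable circle_measure \<and>
          (AE z in circle_measure. f z = f z)"
    "g \<in> borel_measurable circle_measure \<and> g \<in> borel_measurable circle_measure \<and>
          (AE z in circle_measure. g z = g z)"
    "integrable circle_measure (\<lambda>z. (cmod (f z))\<^sup>2)" "integrable circle_measure (\<lambda>z. (cmod (g z))\<^sup>2)"
  have [measurable]: "f \<in> borel_measurable circle_measure" "g \<in> borel_measurable circle_measure"
    using * by auto
  show "integrable circle_measure (\<lambda>z. (cmod (f z + g z))\<^sup>2)"
  proof (rule Bochner_Integration.integrable_bound)
    show "integrable circle_measure (\<lambda>z. 2 * (cmod (f z))\<^sup>2 + 2 * (cmod (g z))\<^sup>2)"
      using * by simp
    show "AE z in circle_measure. norm ((cmod (f z + g z))\<^sup>2)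
            \<le> norm (2 * (cmod (f z))\<^sup>2 + 2 * (cmod (g z))\<^sup>2)"
      using norm_add_square_le[of 1 "f _" "g _"] by (intro AE_I2) simp
  qed measurable
qed

lemma L2_diff:
  assumes "f \<in> L2" "g \<in> L2"
  shows "f - g \<in> L2"
proof -
  have "- g \<in> L2" using assms(2) unfolding L2_def mem_Collect_eq by transfer simp
  from L2_add[OF assms(1) this] show ?thesis by simp
qed

lemma L2_norm_add_square_le:
  assumes "f \<in> L2" "g \<in> L2" "t > 0"
  shows "(L2_norm (f + g))\<^sup>2 \<le> (1 + t) * (L2_norm f)\<^sup>2 + (1 + 1 / t) * (L2_norm g)\<^sup>2"
  using assms(3,1,2) L2_add[OF assms(1,2)] unfolding L2_def mem_Collect_eq
proof transfer
  fix f g :: "complex \<Rightarrow> complex" and t :: real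
  assume *: "0 < t"
    "integrable circle_measure (\<lambda>z. (cmod (f z))\<^sup>2)"
    "integrable circle_measure (\<lambda>z. (cmod (g z))\<^sup>2)"
    "integrable circle_measure (\<lambda>z. (cmod (f z + g z))\<^sup>2)"
  have "(LINT z|circle_measure. (cmod (f z + g z))\<^sup>2)
      \<le> (LINT z|circle_measure. (1 + t) * (cmod (f z))\<^sup>2 + (1 + 1 / t) * (cmod (g z))\<^sup>2)"
    using * norm_add_square_le[OF *(1)] by (intro integral_mono) auto
  also have "\<dots> = (1 + t) * (LINT z|circle_measure. (cmod (f z))\<^sup>2)
      + (1 + 1 / t) * (LINT z|circle_measure. (cmod (g z))\<^sup>2)"
    using * by simp
  finally show "(sqrt (LINT z|circle_measure. (cmod (f z + g z))\<^sup>2))\<^sup>2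
      \<le> (1 + t) * (sqrt (LINT z|circle_measure. (cmod (f z))\<^sup>2))\<^sup>2
      + (1 + 1 / t) * (sqrt (LINT z|circle_measure. (cmod (g z))\<^sup>2))\<^sup>2"
    by simp
qed

lemma L2_norm_triangle:
  assumes "f \<in> L2" "g \<in> L2"
  shows "L2_norm (f + g) \<le> L2_norm f + L2_norm g"
proof (rule field_le_epsilon)
  fix e :: real assume "e > 0"
  define a b where "a = L2_norm f + e / 2" and "b = L2_norm g + e / 2"
  have ab: "a > 0" "b > 0" "L2_norm f \<le> a" "L2_norm g \<le> b"
    using \<open>e > 0\<close> by (auto simp: a_def b_def add_nonneg_pos)
  have "(L2_norm (f + g))\<^sup>2 \<le> (1 + b / a) * (L2_norm f)\<^sup>2 + (1 + 1 / (b / a)) * (L2_norm g)\<^sup>2"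
    using assms ab by (intro L2_norm_add_square_le) auto
  also have "\<dots> \<le> (1 + b / a) * a\<^sup>2 + (1 + 1 / (b / a)) * b\<^sup>2"
    using ab by (intro add_mono mult_left_mono power_mono add_nonneg_nonneg) simp_all
  also have "\<dots> = (a + b)\<^sup>2"
  proof -
    have "(1 + b / a) * a\<^sup>2 = a\<^sup>2 + a * b" "(1 + 1 / (b / a)) * b\<^sup>2 = b\<^sup>2 + a * b"
      using ab(1,2) by (simp_all add: distrib_right power2_eq_square)
    then show ?thesis by (simp add: power2_sum)
  qed
  finally have "L2_norm (f + g) \<le> a + b"
    by (rule power2_le_imp_le) (use ab in simp)
  then show "L2_norm (f + g) \<le> L2_norm f + L2_norm g + e"
    by (simp add: a_def b_def)
qed

lemma L2_norm_eq_0_iff: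
  assumes "f \<in> L2"
  shows "L2_norm f = 0 \<longleftrightarrow> f = 0"
  using assms unfolding L2_def mem_Collect_eq
proof transfer
  fix f :: "complex \<Rightarrow> complex"
  assume "integrable circle_measure (\<lambda>z. (cmod (f z))\<^sup>2)"
    and "f \<in> borel_measurable circle_measure \<and> f \<in> borel_measurable circle_measure \<and>
          (AE z in circle_measure. f z = f z)"
  then show "sqrt (LINT z|circle_measure. (cmod (f z))\<^sup>2) = 0 \<longleftrightarrow>
      (f \<in> borel_measurable circle_measure \<and> (\<lambda>_. 0::complex) \<in> borel_measurable circle_measure \<and>
          (AE z in circle_measure. f z = 0))"
    by (simp add: integral_nonneg_eq_0_iff_AE)
qed

global_interpretation L2: Metric_space L2 "\<lambda>f g. L2_norm (f - g)"
proof
  fix f g h assume "f \<in> L2" "g \<in> L2" "h \<in> L2"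
  then show "L2_norm (f - h) \<le> L2_norm (f - g) + L2_norm (g - h)"
    using L2_norm_triangle[of "f - g" "g - h"] by (simp add: L2_diff)
qed (auto simp: L2_norm_minus_commute L2_norm_eq_0_iff L2_diff)

definition closed_subspace :: "circle_fun set \<Rightarrow> bool" where
  "closed_subspace M \<longleftrightarrow> csubspace M \<and> closedin L2.mtopology M"

text \<open>
  For a closed subspace \<open>N\<close> and \<open>f \<in> L\<^sup>2\<close> such a \<open>p\<close> exists uniquely, by completeness of \<open>L\<^sup>2\<close>.
\<close>

definition orth_proj :: "circle_fun set \<Rightarrow> circle_fun \<Rightarrow> circle_fun" where
  "orth_proj N f = (THE p. p \<in> N \<and> (\<forall>q\<in>N. L2_inner (f - p) q = 0))"

definition gen_toeplitz ::
    "circle_fun \<Rightarrow> circle_fun set \<Rightarrow> circle_fun set \<Rightarrow> circle_fun \<Rightarrow> circle_fun" where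
  "gen_toeplitz \<phi> M N = (\<lambda>f\<in>M. orth_proj N (\<phi> * f))"

definition ker_toeplitz ::
    "circle_fun \<Rightarrow> circle_fun set \<Rightarrow> circle_fun set \<Rightarrow> circle_fun set" where
  "ker_toeplitz \<phi> M N = {f \<in> M. gen_toeplitz \<phi> M N f = 0}"

end

theory Submission
  imports Defs
begin

text \<open>
  The kernel of a generalized Toeplitz operator is described by orthogonality: \<open>f \<in> M\<close> is
  annihilated iff \<open>\<phi> f\<close> is orthogonal to \<open>N\<close> (\<open>ker_toeplitz_iff\<close>). Multiplication by
  \<open>cnj a\<^sub>2\<close> is the adjoint of multiplication by \<open>a\<^sub>2\<close>, so
  \<open>\<langle>cnj a\<^sub>2 \<psi> a\<^sub>1 f, q\<rangle> = \<langle>\<psi> (a\<^sub>1 f), a\<^sub>2 q\<rangle>\<close>. As \<open>q\<close> runs through \<open>K\<^sub>2\<close>, the product \<open>a\<^sub>2 q\<close> runs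
  through \<open>H\<^sub>2\<close>; hence \<open>f \<in> K\<^sub>1\<close> lies in the kernel for the symbol \<open>cnj a\<^sub>2 \<psi> a\<^sub>1\<close> iff
  \<open>a\<^sub>1 f \<in> H\<^sub>1\<close> lies in the kernel for \<open>\<psi>\<close>. Thus the former kernel is \<open>a\<^sub>1\<^sup>-\<^sup>1\<close> times the latter
  (\<open>ker_toeplitz_twist\<close>), which by hypothesis is the kernel for \<open>\<phi>\<close>.

  The orthogonality criterion rests on the existence of orthogonal projections: a vanishing
  \<open>orth_proj N f\<close>, being a definite description, gives information about \<open>f\<close> only once the
  described element is known to exist. Most of the work goes into this: \<open>L\<^sup>2\<close> is complete, hence a
  closed subspace contains a point nearest to \<open>f\<close>, and the difference between \<open>f\<close> and this point
  is orthogonal to the subspace.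
\<close>

section \<open>Completeness of \<open>L\<^sup>2\<close>\<close>

text \<open>
  Riesz--Fischer, for sequences whose Cauchy modulus is summable. On a finite measure space the
  increments then have summable \<open>L\<^sup>1\<close> norms, so the sequence converges absolutely almost
  everywhere; Fatou's lemma carries the bounds over to the pointwise limit.
\<close>

lemma L2_Cauchy_limit:
  fixes f :: "nat \<Rightarrow> 'a \<Rightarrow> 'b :: {banach, second_countable_topology}"
  assumes "finite_measure M"
    and [measurable]: "\<And>n. f n \<in> borel_measurable M"
    and e: "\<And>n. e n > 0" "summable e"
    and int: "\<And>m n. n \<le> m \<Longrightarrow> integrable M (\<lambda>x. (norm (f m x - f n x))\<^sup>2)"
    and le: "\<And>m n. n \<le> m \<Longrightarrow> (LINT x|M. (norm (f m x - f n x))\<^sup>2) \<le> (e n)\<^sup>2"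
  obtains g where "g \<in> borel_measurable M"
    "\<And>n. integrable M (\<lambda>x. (norm (g x - f n x))\<^sup>2)"
    "\<And>n. (LINT x|M. (norm (g x - f n x))\<^sup>2) \<le> (e n)\<^sup>2"
proof -
  interpret finite_measure M by fact
  define h where "h n x = norm (f (Suc n) x - f n x)" for n x
  have [measurable]: "h n \<in> borel_measurable M" for n
    unfolding h_def by measurable
  have h_nn: "0 \<le> h n x" for n x by (simp add: h_def)
  define C where "C = measure M (space M) + 1"
  have h_bound: "(\<integral>\<^sup>+x. ennreal (h n x) \<partial>M) \<le> ennreal (C * e n)" for n
  proof -
    have I: "integrable M (\<lambda>x. e n + (h n x)\<^sup>2 / e n)"
      using int[of n "Suc n"] by (simp add: h_def)
    \<comment> \<open>AM-GM with weight \<open>e n\<close> bounds the \<open>L\<^sup>1\<close> norm of the increment linearly in \<open>e n\<close>; it stands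
        in for the Cauchy--Schwarz inequality.\<close>
    have amgm: "h n x \<le> e n + (h n x)\<^sup>2 / e n" for x
    proof -
      have "h n x * e n \<le> (e n)\<^sup>2 + (h n x)\<^sup>2"
        using sum_squares_bound[of "h n x" "e n"] mult_nonneg_nonneg[OF h_nn[of n x] less_imp_le[OF e(1)[of n]]]
        by (simp add: algebra_simps)
      then show ?thesis using e(1)[of n] by (simp add: field_simps power2_eq_square)
    qed
    have "(\<integral>\<^sup>+x. ennreal (h n x) \<partial>M) \<le> (\<integral>\<^sup>+x. ennreal (e n + (h n x)\<^sup>2 / e n) \<partial>M)"
      by (intro nn_integral_mono ennreal_leI amgm)
    also have "\<dots> = ennreal (LINT x|M. e n + (h n x)\<^sup>2 / e n)"
      using order_less_imp_le[OF e(1)] by (intro nn_integral_eq_integral I AE_I2) auto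
    also have "(LINT x|M. e n + (h n x)\<^sup>2 / e n)
        = e n * measure M (space M) + (LINT x|M. (h n x)\<^sup>2) / e n"
      using int[of n "Suc n"] by (simp add: h_def)
    also have "(LINT x|M. (h n x)\<^sup>2) / e n \<le> (e n)\<^sup>2 / e n"
      using le[of n "Suc n"] e(1)[of n] by (intro divide_right_mono) (auto simp: h_def)
    also have "(e n)\<^sup>2 / e n = e n" using e(1)[of n] by (simp add: power2_eq_square)
    finally show ?thesis by (simp add: C_def algebra_simps ennreal_leI)
  qed
  have "C \<ge> 0" by (simp add: C_def)
  have "(\<integral>\<^sup>+x. (\<Sum>n. ennreal (h n x)) \<partial>M) = (\<Sum>n. \<integral>\<^sup>+x. ennreal (h n x) \<partial>M)"
    by (rule nn_integral_suminf) measurable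
  also have "\<dots> \<le> (\<Sum>n. ennreal (C * e n))"
    by (intro suminf_le h_bound) auto
  also have "\<dots> = ennreal (\<Sum>n. C * e n)"
    using e \<open>C \<ge> 0\<close>
    by (intro suminf_ennreal2 summable_mult mult_nonneg_nonneg) (auto intro: less_imp_le)
  also have "\<dots> < \<infinity>" by simp
  finally have "AE x in M. (\<Sum>n. ennreal (h n x)) \<noteq> \<infinity>"
    by (intro nn_integral_noteq_infinite) auto
  then have conv: "AE x in M. (\<lambda>n. f n x) \<longlonglongrightarrow> lim (\<lambda>n. f n x)"
  proof eventually_elim
    case (elim x)
    have "summable (\<lambda>n. h n x)"
      using elim by (intro summable_suminf_not_top h_nn) auto
    then have "summable (\<lambda>n. f (Suc n) x - f n x)"
      by (intro summable_norm_cancel[of "\<lambda>n. f (Suc n) x - f n x"]) (simp add: h_def)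
    then have "convergent (\<lambda>n. \<Sum>k<n. f (Suc k) x - f k x)"
      by (simp add: summable_iff_convergent)
    then have "convergent (\<lambda>n. f n x - f 0 x)"
      using sum_lessThan_telescope[of "\<lambda>n. f n x"] by simp
    then have "convergent (\<lambda>n. f n x)"
      by (simp add: convergent_diff_const_right_iff)
    then show ?case by (simp add: convergent_LIMSEQ_iff)
  qed
  define g where "g x = lim (\<lambda>n. f n x)" for x
  have g[measurable]: "g \<in> borel_measurable M"
    unfolding g_def by (rule borel_measurable_lim_metric) measurable
  have fatou: "(\<integral>\<^sup>+x. ennreal ((norm (g x - f n x))\<^sup>2) \<partial>M) \<le> ennreal ((e n)\<^sup>2)" for n
  proof -
    have "AE x in M. ennreal ((norm (g x - f n x))\<^sup>2)
        = liminf (\<lambda>m. ennreal ((norm (f m x - f n x))\<^sup>2))"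
      using conv
    proof eventually_elim
      case (elim x)
      have "(\<lambda>m. ennreal ((norm (f m x - f n x))\<^sup>2)) \<longlonglongrightarrow> ennreal ((norm (g x - f n x))\<^sup>2)"
        using elim unfolding g_def by (intro tendsto_ennrealI tendsto_intros)
      then show ?case by (intro lim_imp_Liminf[symmetric]) auto
    qed
    then have "(\<integral>\<^sup>+x. ennreal ((norm (g x - f n x))\<^sup>2) \<partial>M)
        = (\<integral>\<^sup>+x. liminf (\<lambda>m. ennreal ((norm (f m x - f n x))\<^sup>2)) \<partial>M)"
      by (rule nn_integral_cong_AE)
    also have "\<dots> \<le> liminf (\<lambda>m. \<integral>\<^sup>+x. ennreal ((norm (f m x - f n x))\<^sup>2) \<partial>M)"
      by (rule nn_integral_liminf) measurable
    also have "\<dots> \<le> ennreal ((e n)\<^sup>2)"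
    proof (intro Liminf_le)
      show "\<forall>\<^sub>F m in sequentially. (\<integral>\<^sup>+x. ennreal ((norm (f m x - f n x))\<^sup>2) \<partial>M)
              \<le> ennreal ((e n)\<^sup>2)"
        using eventually_ge_at_top[of n]
      proof eventually_elim
        case (elim m)
        have "(\<integral>\<^sup>+x. ennreal ((norm (f m x - f n x))\<^sup>2) \<partial>M)
            = ennreal (LINT x|M. (norm (f m x - f n x))\<^sup>2)"
          by (intro nn_integral_eq_integral int elim) auto
        with le[OF elim] show ?case by (simp add: ennreal_leI)
      qed
    qed simp
    finally show ?thesis .
  qed
  have gint: "integrable M (\<lambda>x. (norm (g x - f n x))\<^sup>2)" for n
    using le_less_trans[OF fatou[of n] ennreal_less_top]
    by (intro integrableI_nonneg) auto
  moreover have "(LINT x|M. (norm (g x - f n x))\<^sup>2) \<le> (e n)\<^sup>2" for n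
  proof -
    have "ennreal (LINT x|M. (norm (g x - f n x))\<^sup>2)
        = (\<integral>\<^sup>+x. ennreal ((norm (g x - f n x))\<^sup>2) \<partial>M)"
      by (intro nn_integral_eq_integral[symmetric] gint) auto
    with fatou[of n] show ?thesis by (metis ennreal_le_iff zero_le_power2)
  qed
  ultimately show thesis using g that by blast
qed

lemma finite_measure_circle: "finite_measure circle_measure"
  by (rule finite_measureI) (simp add: emeasure_space_circle_measure)

lemma L2_complete:
  assumes p: "\<And>n. p n \<in> L2" and e: "\<And>n. e n > 0" "summable e"
    and le: "\<And>m n. n \<le> m \<Longrightarrow> L2_norm (p m - p n) \<le> e n"
  obtains q where "q \<in> L2" "\<And>n. L2_norm (q - p n) \<le> e n"
proof -
  have "\<exists>q. square_integrable q \<and> (\<forall>n. L2_norm (q - p n) \<le> e n)"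
    if "\<forall>n. square_integrable (p n)"
      "\<forall>m n. n \<le> m \<longrightarrow> square_integrable (p m - p n)"
      "\<forall>m n. n \<le> m \<longrightarrow> L2_norm (p m - p n) \<le> e n"
    using that
  proof (transfer fixing: e)
    fix p :: "nat \<Rightarrow> complex \<Rightarrow> complex"
    assume "pred_fun top (\<lambda>f. f \<in> borel_measurable circle_measure \<and>
          f \<in> borel_measurable circle_measure \<and> (AE z in circle_measure. f z = f z)) p"
      and p: "\<forall>n. integrable circle_measure (\<lambda>z. (cmod (p n z))\<^sup>2)"
        "\<forall>m n. n \<le> m \<longrightarrow> integrable circle_measure (\<lambda>z. (cmod (p m z - p n z))\<^sup>2)"
        "\<forall>m n. n \<le> m \<longrightarrow> sqrt (LINT z|circle_measure. (cmod (p m z - p n z))\<^sup>2) \<le> e n"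
    then have [measurable]: "p n \<in> borel_measurable circle_measure" for n
      by (auto simp: pred_fun_def)
    have le: "(LINT z|circle_measure. (cmod (p m z - p n z))\<^sup>2) \<le> (e n)\<^sup>2" if "n \<le> m" for m n
      using p(3) that by (auto intro: sqrt_le_D)
    obtain q where [measurable]: "q \<in> borel_measurable circle_measure"
      and q: "\<And>n. integrable circle_measure (\<lambda>z. (cmod (q z - p n z))\<^sup>2)"
        "\<And>n. (LINT z|circle_measure. (cmod (q z - p n z))\<^sup>2) \<le> (e n)\<^sup>2"
      using L2_Cauchy_limit[OF finite_measure_circle, of p e] e p(2) le by auto
    have "integrable circle_measure (\<lambda>z. (cmod (q z))\<^sup>2)"
    proof (rule Bochner_Integration.integrable_bound)
      show "integrable circle_measure (\<lambda>z. 2 * (cmod (q z - p 0 z))\<^sup>2 + 2 * (cmod (p 0 z))\<^sup>2)"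
        using q(1) p(1) by simp
      have "norm ((cmod (q z))\<^sup>2) \<le> norm (2 * (cmod (q z - p 0 z))\<^sup>2 + 2 * (cmod (p 0 z))\<^sup>2)" for z
        using norm_add_square_le[of 1 "q z - p 0 z" "p 0 z"] by simp
      then show "AE z in circle_measure. norm ((cmod (q z))\<^sup>2)
          \<le> norm (2 * (cmod (q z - p 0 z))\<^sup>2 + 2 * (cmod (p 0 z))\<^sup>2)"
        by (intro AE_I2)
    qed measurable
    moreover have "sqrt (LINT z|circle_measure. (cmod (q z - p n z))\<^sup>2) \<le> e n" for n
      using q(2)[of n] e(1)[of n] by (intro real_le_lsqrt) auto
    ultimately show "\<exists>q\<in>{f \<in> borel_measurable circle_measure.
          f \<in> borel_measurable circle_measure \<and> (AE z in circle_measure. f z = f z)}.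
          integrable circle_measure (\<lambda>z. (cmod (q z))\<^sup>2) \<and>
          (\<forall>n. sqrt (LINT z|circle_measure. (cmod (q z - p n z))\<^sup>2) \<le> e n)"
      by (intro bexI[of _ q]) auto
  qed
  moreover have "square_integrable (p n)" "square_integrable (p m - p n)" for m n
    using p[of m] p[of n] L2_diff[of "p m" "p n"] by (auto simp: L2_def)
  ultimately show thesis using le that by (auto simp: L2_def)
qed

section \<open>Multiplication operators and the inner product\<close>

lemma Linf_mult_L2:
  assumes "g \<in> Linf" "f \<in> L2"
  shows "g * f \<in> L2"
  using assms unfolding L2_def Linf_def mem_Collect_eq
proof (transfer, elim exE)
  fix f g :: "complex \<Rightarrow> complex" and C :: real
  assume meas: "f \<in> borel_measurable circle_measure \<and> f \<in> borel_measurable circle_measure \<and>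
      (AE z in circle_measure. f z = f z)" "g \<in> borel_measurable circle_measure \<and> g \<in> borel_measurable circle_measure \<and>
      (AE z in circle_measure. g z = g z)"
    and C: "AE z in circle_measure. cmod (g z) \<le> C"
    and f: "integrable circle_measure (\<lambda>z. (cmod (f z))\<^sup>2)"
  show "integrable circle_measure (\<lambda>z. (cmod (g z * f z))\<^sup>2)"
  proof (rule Bochner_Integration.integrable_bound)
    show "integrable circle_measure (\<lambda>z. C\<^sup>2 * (cmod (f z))\<^sup>2)" using f by simp
    show "AE z in circle_measure. norm ((cmod (g z * f z))\<^sup>2) \<le> norm (C\<^sup>2 * (cmod (f z))\<^sup>2)"
      using C
    proof eventually_elim
      case (elim z)
      then have "(cmod (g z))\<^sup>2 \<le> C\<^sup>2" by (intro power_mono) auto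
      then show ?case by (simp add: norm_mult power_mult_distrib mult_right_mono)
    qed
  qed (use meas in auto)
qed

lemma Linf_mult: "f \<in> Linf \<Longrightarrow> g \<in> Linf \<Longrightarrow> f * g \<in> Linf"
  unfolding Linf_def mem_Collect_eq
proof (transfer, elim exE)
  fix f g :: "complex \<Rightarrow> complex" and C D
  assume "AE z in circle_measure. cmod (f z) \<le> C" "AE z in circle_measure. cmod (g z) \<le> D"
  then have "AE z in circle_measure. cmod (f z * g z) \<le> C * D"
  proof eventually_elim
    case (elim z)
    then show ?case
      by (auto simp: norm_mult intro!: mult_mono order_trans[OF norm_ge_zero elim(1)])
  qed
  then show "\<exists>C. AE z in circle_measure. cmod (f z * g z) \<le> C" by blast
qed

lemma Linf_cnj: "f \<in> Linf \<Longrightarrow> cnj_fun f \<in> Linf"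
  unfolding Linf_def mem_Collect_eq by transfer simp

lemma GLinf_inverse_cancel: "a \<in> GLinf \<Longrightarrow> inverse a * a = 1"
proof -
  have "nonzero_AE a \<Longrightarrow> inverse a * a = 1" by transfer auto
  then show "a \<in> GLinf \<Longrightarrow> inverse a * a = 1" by (simp add: GLinf_def)
qed

lemma integrable_L2_product:
  fixes f g :: "'a \<Rightarrow> complex"
  assumes [measurable]: "f \<in> borel_measurable M" "g \<in> borel_measurable M"
    and "integrable M (\<lambda>z. (cmod (f z))\<^sup>2)" "integrable M (\<lambda>z. (cmod (g z))\<^sup>2)"
  shows "integrable M (\<lambda>z. f z * cnj (g z))"
proof (rule Bochner_Integration.integrable_bound)
  show "integrable M (\<lambda>z. (cmod (f z))\<^sup>2 + (cmod (g z))\<^sup>2)" using assms by simp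
  have "norm (f z * cnj (g z)) \<le> norm ((cmod (f z))\<^sup>2 + (cmod (g z))\<^sup>2)" for z
    using sum_squares_bound[of "cmod (f z)" "cmod (g z)"]
      mult_nonneg_nonneg[OF norm_ge_zero[of "f z"] norm_ge_zero[of "g z"]]
    unfolding norm_mult complex_mod_cnj real_norm_def by linarith
  then show "AE z in M. norm (f z * cnj (g z)) \<le> norm ((cmod (f z))\<^sup>2 + (cmod (g z))\<^sup>2)"
    by (intro AE_I2)
qed measurable

lemma L2_inner_diff_left:
  assumes "f \<in> L2" "g \<in> L2" "h \<in> L2"
  shows "L2_inner (f - g) h = L2_inner f h - L2_inner g h"
  using assms unfolding L2_def mem_Collect_eq
  by transfer (simp add: left_diff_distrib integrable_L2_product)

lemma L2_inner_cnj_mult: "L2_inner (cnj_fun a * f) g = L2_inner f (a * g)"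
  by transfer (simp add: mult_ac)

lemma L2_norm_square_eq_inner: "L2_inner f f = of_real ((L2_norm f)\<^sup>2)"
  by transfer (simp flip: complex_norm_square integral_complex_of_real)

text \<open>
  A single expansion with two uses: \<open>c = 1\<close> and \<open>c = -1\<close> together give the
  parallelogram law, and small multiples \<open>c\<close> of \<open>\<langle>f, g\<rangle>\<close> give orthogonality at a nearest point.
\<close>

lemma L2_norm_diff_scale_square:
  assumes "f \<in> L2" "g \<in> L2"
  shows "(L2_norm (f - scaleC_fun c g))\<^sup>2
    = (L2_norm f)\<^sup>2 - 2 * Re (cnj c * L2_inner f g) + (cmod c)\<^sup>2 * (L2_norm g)\<^sup>2"
  using assms unfolding L2_def mem_Collect_eq
proof transfer
  fix f g :: "complex \<Rightarrow> complex" and c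
  assume *: "f \<in> borel_measurable circle_measure \<and> f \<in> borel_measurable circle_measure \<and>
      (AE z in circle_measure. f z = f z)" "g \<in> borel_measurable circle_measure \<and> g \<in> borel_measurable circle_measure \<and>
      (AE z in circle_measure. g z = g z)"
    and f: "integrable circle_measure (\<lambda>z. (cmod (f z))\<^sup>2)"
    and g: "integrable circle_measure (\<lambda>z. (cmod (g z))\<^sup>2)"
  have sq: "(sqrt (LINT z|circle_measure. (cmod (u z))\<^sup>2))\<^sup>2 = (LINT z|circle_measure. (cmod (u z))\<^sup>2)"
    for u :: "complex \<Rightarrow> complex"
    by (rule real_sqrt_pow2) simp
  have pw: "(cmod (f z - c * g z))\<^sup>2
      = (cmod (f z))\<^sup>2 - 2 * Re (cnj c * (f z * cnj (g z))) + (cmod c)\<^sup>2 * (cmod (g z))\<^sup>2" for z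
    unfolding cmod_power2 by (simp add: power2_eq_square algebra_simps)
  have I: "integrable circle_measure (\<lambda>z. cnj c * (f z * cnj (g z)))"
    using * f g by (intro integrable_mult_right integrable_L2_product) auto
  then have IR: "integrable circle_measure (\<lambda>z. Re (cnj c * (f z * cnj (g z))))"
    by (rule integrable_Re)
  have "(LINT z|circle_measure. Re (cnj c * (f z * cnj (g z))))
      = Re (cnj c * (LINT z|circle_measure. f z * cnj (g z)))"
    unfolding integral_Re[OF I] by (subst integral_mult_right_zero) simp
  then show "(sqrt (LINT z|circle_measure. (cmod (f z - c * g z))\<^sup>2))\<^sup>2 =
     (sqrt (LINT z|circle_measure. (cmod (f z))\<^sup>2))\<^sup>2
     - 2 * Re (cnj c * (LINT z|circle_measure. f z * cnj (g z)))
     + (cmod c)\<^sup>2 * (sqrt (LINT z|circle_measure. (cmod (g z))\<^sup>2))\<^sup>2"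
    unfolding sq unfolding pw using f g IR by (simp del: times_complex.sel)
qed

lemma L2_parallelogram:
  assumes "f \<in> L2" "g \<in> L2"
  shows "(L2_norm (f - g))\<^sup>2 + (L2_norm (f + g))\<^sup>2 = 2 * (L2_norm f)\<^sup>2 + 2 * (L2_norm g)\<^sup>2"
proof -
  have "scaleC_fun 1 g = g" "scaleC_fun (-1) g = - g" by (transfer; simp)+
  then show ?thesis
    using L2_norm_diff_scale_square[OF assms, of 1] L2_norm_diff_scale_square[OF assms, of "-1"]
    by simp
qed

lemma L2_norm_scale: "L2_norm (scaleC_fun c f) = cmod c * L2_norm f"
  by transfer (simp add: norm_mult power_mult_distrib real_sqrt_mult)

section \<open>Orthogonal projection\<close>

lemma closed_subspace_L2: "closed_subspace N \<Longrightarrow> N \<subseteq> L2"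
  unfolding closed_subspace_def using closedin_subset by fastforce

lemma closed_subspace_limit:
  assumes "closed_subspace N" "\<And>n. p n \<in> N" "q \<in> L2" "\<And>n. L2_norm (q - p n) \<le> e n" "e \<longlonglongrightarrow> 0"
  shows "q \<in> N"
proof (rule ccontr)
  assume "q \<notin> N"
  then obtain r where r: "r > 0" "disjnt N (L2.mball q r)"
    using assms(1,3) unfolding closed_subspace_def L2.closedin_metric by blast
  obtain n where "e n < r"
    using order_tendstoD(2)[OF assms(5) r(1)] by (auto simp: eventually_sequentially)
  then have "p n \<in> L2.mball q r"
    using assms(2)[of n] assms(3) assms(4)[of n] closed_subspace_L2[OF assms(1)] by auto
  with r(2) assms(2)[of n] show False by (auto simp: disjnt_iff)
qed

text \<open>
  In the parallelogram law for \<open>f - a\<close> and \<open>f - b\<close>, this turns the norm of the sum into a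
  distance from \<open>f\<close> to a point of the subspace, which the infimum bounds from below.
\<close>

lemma sum_eq_twice_midpoint:
  "(f - a) + (f - b) = scaleC_fun 2 (f - scaleC_fun (1/2) (b + a))"
  by transfer (auto simp: algebra_simps)

text \<open>
  By the parallelogram law a minimizing sequence is Cauchy. Choosing its terms within
  \<open>(e n)\<^sup>2 / 4\<close> of the infimum of the squared distances makes the Cauchy modulus equal to the
  summable sequence \<open>e n = 2\<^sup>-\<^sup>n\<close>, as completeness was proved for such sequences only.
\<close>

lemma nearest_point_exists:
  assumes N: "closed_subspace N" and f: "f \<in> L2"
  obtains p where "p \<in> N" "\<And>q. q \<in> N \<Longrightarrow> L2_norm (f - p) \<le> L2_norm (f - q)"
proof -
  define d where "d = (INF q\<in>N. (L2_norm (f - q))\<^sup>2)"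
  have sub: "csubspace N" using N by (simp add: closed_subspace_def)
  have N0: "0 \<in> N" by (rule circle_fun.subspace_0[OF sub])
  have NL: "q \<in> L2" if "q \<in> N" for q using that closed_subspace_L2[OF N] by blast
  have bdd: "bdd_below ((\<lambda>q. (L2_norm (f - q))\<^sup>2) ` N)" by (intro bdd_belowI2[of _ 0]) simp
  have d_le: "d \<le> (L2_norm (f - q))\<^sup>2" if "q \<in> N" for q
    unfolding d_def by (rule cINF_lower[OF bdd that])
  define e :: "nat \<Rightarrow> real" where "e n = (1/2)^n" for n
  have e_pos: "e n > 0" for n by (simp add: e_def)
  have e_mono: "e m \<le> e n" if "n \<le> m" for m n
    using that unfolding e_def by (intro power_decreasing) auto
  have "\<exists>q\<in>N. (L2_norm (f - q))\<^sup>2 < d + (e n)\<^sup>2 / 4" for n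
  proof -
    have "d < d + (e n)\<^sup>2 / 4" using e_pos[of n] by simp
    then show ?thesis using cINF_less_iff[OF _ bdd] N0 unfolding d_def by blast
  qed
  then obtain p where p: "\<And>n. p n \<in> N" "\<And>n. (L2_norm (f - p n))\<^sup>2 < d + (e n)\<^sup>2 / 4" by metis
  have cauchy: "L2_norm (p m - p n) \<le> e n" if "n \<le> m" for m n
  proof -
    let ?c = "scaleC_fun (1/2) (p m + p n)"
    have "?c \<in> N" using sub p by (intro circle_fun.subspace_scale circle_fun.subspace_add)
    have "(f - p n) + (f - p m) = scaleC_fun 2 (f - ?c)" by (rule sum_eq_twice_midpoint)
    then have "(L2_norm ((f - p n) + (f - p m)))\<^sup>2 = 4 * (L2_norm (f - ?c))\<^sup>2"
      by (simp add: L2_norm_scale power_mult_distrib)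
    moreover have "(f - p n) - (f - p m) = p m - p n" by simp
    ultimately have "(L2_norm (p m - p n))\<^sup>2
        = 2 * (L2_norm (f - p n))\<^sup>2 + 2 * (L2_norm (f - p m))\<^sup>2 - 4 * (L2_norm (f - ?c))\<^sup>2"
      using L2_parallelogram[of "f - p n" "f - p m"] f p(1) NL by (simp add: L2_diff)
    also have "\<dots> \<le> (e n)\<^sup>2 / 2 + (e m)\<^sup>2 / 2"
      using p(2)[of n] p(2)[of m] d_le[OF \<open>?c \<in> N\<close>] by (simp add: field_simps)
    also have "\<dots> \<le> (e n)\<^sup>2"
      using power_mono[OF e_mono[OF that] less_imp_le[OF e_pos], of 2] by simp
    finally show ?thesis by (rule power2_le_imp_le) (rule less_imp_le[OF e_pos])
  qed
  have sum: "summable e" unfolding e_def by (rule summable_geometric) simp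
  obtain q where q: "q \<in> L2" "\<And>n. L2_norm (q - p n) \<le> e n"
    using L2_complete[of p e] cauchy sum e_pos p(1) NL by blast
  have e0: "e \<longlonglongrightarrow> 0" using sum by (rule summable_LIMSEQ_zero)
  have "q \<in> N" by (rule closed_subspace_limit[OF N p(1) q e0])
  moreover have "L2_norm (f - q) \<le> L2_norm (f - r)" if "r \<in> N" for r
  proof -
    have "L2_norm (f - q) \<le> sqrt (d + (e n)\<^sup>2 / 4) + e n" for n
    proof -
      have "L2_norm (f - q) \<le> L2_norm (f - p n) + L2_norm (p n - q)"
        using L2_norm_triangle[of "f - p n" "p n - q"] f p(1) NL q(1) by (simp add: L2_diff)
      moreover have "L2_norm (f - p n) \<le> sqrt (d + (e n)\<^sup>2 / 4)"
        using p(2)[of n] by (intro real_le_rsqrt) simp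
      ultimately show ?thesis using q(2)[of n] by (simp add: L2_norm_minus_commute)
    qed
    moreover have "(\<lambda>n. sqrt (d + (e n)\<^sup>2 / 4) + e n) \<longlonglongrightarrow> sqrt (d + 0\<^sup>2 / 4) + 0"
      by (intro tendsto_intros e0) simp
    ultimately have "L2_norm (f - q) \<le> sqrt (d + 0\<^sup>2 / 4) + 0"
      by (intro LIMSEQ_le_const) auto
    also have "\<dots> \<le> L2_norm (f - r)"
      using d_le[OF that] by (simp add: real_le_lsqrt)
    finally show ?thesis .
  qed
  ultimately show thesis using that by blast
qed

text \<open>
  First variation: moving \<open>g\<close> by a small multiple of \<open>q\<close> in the direction of \<open>\<langle>g, q\<rangle>\<close> lowers the
  norm to first order unless \<open>\<langle>g, q\<rangle> = 0\<close>.
\<close>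

lemma nearest_point_orthogonal:
  assumes "g \<in> L2" "q \<in> L2" and le: "\<And>c. L2_norm g \<le> L2_norm (g - scaleC_fun c q)"
  shows "L2_inner g q = 0"
proof -
  define b where "b = L2_inner g q"
  \<comment> \<open>With this step the second-order term is at most half of the first-order gain; the summand
      \<open>1\<close> covers \<open>q = 0\<close>.\<close>
  define t where "t = 1 / ((L2_norm q)\<^sup>2 + 1)"
  have pos: "(L2_norm q)\<^sup>2 + 1 > 0" by (simp add: add_nonneg_pos)
  have t: "t > 0" "t * (L2_norm q)\<^sup>2 \<le> 1" using pos by (auto simp: t_def)
  have "(L2_norm g)\<^sup>2 \<le> (L2_norm (g - scaleC_fun (of_real t * b) q))\<^sup>2"
    by (intro power_mono le) simp
  also have "\<dots> = (L2_norm g)\<^sup>2 - 2 * (t * (cmod b)\<^sup>2) + (t * cmod b)\<^sup>2 * (L2_norm q)\<^sup>2"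
  proof -
    have "Re (cnj (of_real t * b) * b) = t * (cmod b)\<^sup>2"
      unfolding cmod_power2 by (simp add: power2_eq_square algebra_simps)
    moreover have "cmod (of_real t * b) = t * cmod b"
      using t(1) by (simp add: norm_mult)
    ultimately show ?thesis
      using L2_norm_diff_scale_square[OF assms(1,2), of "of_real t * b"]
      by (simp only: flip: b_def)
  qed
  also have "(t * cmod b)\<^sup>2 * (L2_norm q)\<^sup>2 = (t * (cmod b)\<^sup>2) * (t * (L2_norm q)\<^sup>2)"
    by (simp add: power2_eq_square)
  also have "\<dots> \<le> (t * (cmod b)\<^sup>2) * 1" using t by (intro mult_left_mono) auto
  finally have "t * (cmod b)\<^sup>2 \<le> 0" by simp
  then have "b = 0" using t(1) by (simp add: mult_le_0_iff)
  then show ?thesis by (simp add: b_def)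
qed

lemma orth_proj_unique:
  assumes N: "closed_subspace N" and f: "f \<in> L2"
    and "p \<in> N" "\<And>q. q \<in> N \<Longrightarrow> L2_inner (f - p) q = 0"
    and "p' \<in> N" "\<And>q. q \<in> N \<Longrightarrow> L2_inner (f - p') q = 0"
  shows "p = p'"
proof -
  have L: "p \<in> L2" "p' \<in> L2" using closed_subspace_L2[OF N] assms by auto
  have d: "p - p' \<in> N" using N assms by (auto simp: closed_subspace_def intro: circle_fun.subspace_diff)
  have "p - p' = (f - p') - (f - p)" by simp
  then have "L2_inner (p - p') (p - p') = L2_inner (f - p') (p - p') - L2_inner (f - p) (p - p')"
    using L2_inner_diff_left[of "f - p'" "f - p" "p - p'"] L f by (simp add: L2_diff)
  then have "L2_norm (p - p') = 0"
    using assms(4,6)[OF d] by (simp add: L2_norm_square_eq_inner)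
  then show ?thesis using L by (simp add: L2_norm_eq_0_iff L2_diff)
qed

lemma orth_proj_characterization:
  assumes N: "closed_subspace N" and f: "f \<in> L2"
  shows "orth_proj N f \<in> N \<and> (\<forall>q\<in>N. L2_inner (f - orth_proj N f) q = 0)"
proof -
  have sub: "csubspace N" using N by (simp add: closed_subspace_def)
  have NL: "N \<subseteq> L2" by (rule closed_subspace_L2[OF N])
  obtain p where p: "p \<in> N" "\<And>q. q \<in> N \<Longrightarrow> L2_norm (f - p) \<le> L2_norm (f - q)"
    by (rule nearest_point_exists[OF N f]) blast
  have "L2_inner (f - p) q = 0" if q: "q \<in> N" for q
  proof (rule nearest_point_orthogonal)
    show "f - p \<in> L2" "q \<in> L2" using f p(1) q NL by (auto intro: L2_diff)
    fix c
    have "p + scaleC_fun c q \<in> N"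
      using sub p(1) q by (intro circle_fun.subspace_add circle_fun.subspace_scale)
    from p(2)[OF this] show "L2_norm (f - p) \<le> L2_norm (f - p - scaleC_fun c q)"
      by (simp add: diff_diff_eq)
  qed
  with p(1) show ?thesis
    unfolding orth_proj_def
    by (intro theI[of "\<lambda>p. p \<in> N \<and> (\<forall>q\<in>N. L2_inner (f - p) q = 0)"])
       (auto intro: orth_proj_unique[OF N f])
qed

lemma orth_proj_eq_0_iff:
  assumes "closed_subspace N" "f \<in> L2"
  shows "orth_proj N f = 0 \<longleftrightarrow> (\<forall>q\<in>N. L2_inner f q = 0)"
proof
  assume "orth_proj N f = 0"
  then show "\<forall>q\<in>N. L2_inner f q = 0" using orth_proj_characterization[OF assms] by simp
next
  assume "\<forall>q\<in>N. L2_inner f q = 0"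
  moreover have "0 \<in> N" using assms(1) by (simp add: closed_subspace_def circle_fun.subspace_0)
  ultimately show "orth_proj N f = 0"
    using orth_proj_characterization[OF assms] by (intro orth_proj_unique[OF assms]) auto
qed

section \<open>Kernels of generalized Toeplitz operators\<close>

lemma ker_toeplitz_iff:
  assumes "closed_subspace M" "closed_subspace N" "\<phi> \<in> Linf"
  shows "f \<in> ker_toeplitz \<phi> M N \<longleftrightarrow> f \<in> M \<and> (\<forall>q\<in>N. L2_inner (\<phi> * f) q = 0)"
  using assms closed_subspace_L2[OF assms(1)]
  by (auto simp: ker_toeplitz_def gen_toeplitz_def orth_proj_eq_0_iff Linf_mult_L2 subset_iff)

text \<open>
  Multiplication by \<open>a1\<close> maps \<open>K1\<close> bijectively onto \<open>H1\<close>, while \<open>a2\<close>, moved to the other side of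
  the inner product, turns test functions in \<open>K2\<close> into test functions in \<open>H2\<close>.
\<close>

lemma ker_toeplitz_twist:
  assumes "closed_subspace H1" "closed_subspace H2" "closed_subspace K1" "closed_subspace K2"
    and "\<psi> \<in> Linf" "a1 \<in> GLinf" "a2 \<in> Linf" "(*) a1 ` K1 = H1" "(*) a2 ` K2 = H2"
  shows "ker_toeplitz (cnj_fun a2 * \<psi> * a1) K1 K2 = (*) (inverse a1) ` ker_toeplitz \<psi> H1 H2"
proof -
  have inv: "inverse a1 * (a1 * f) = f" for f
    using GLinf_inverse_cancel[OF assms(6)] by (simp flip: mult.assoc)
  have symb: "cnj_fun a2 * \<psi> * a1 \<in> Linf"
    using assms by (auto simp: GLinf_def intro: Linf_mult Linf_cnj)
  have "L2_inner (cnj_fun a2 * \<psi> * a1 * f) q = L2_inner (\<psi> * (a1 * f)) (a2 * q)" for f q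
    using L2_inner_cnj_mult[of a2 "\<psi> * (a1 * f)" q] by (simp add: mult.assoc)
  then have iff: "f \<in> ker_toeplitz (cnj_fun a2 * \<psi> * a1) K1 K2 \<longleftrightarrow> a1 * f \<in> ker_toeplitz \<psi> H1 H2"
    if "f \<in> K1" for f
    using that assms symb by (auto simp: ker_toeplitz_iff)
  show ?thesis
  proof (intro equalityI subsetI)
    fix f assume "f \<in> ker_toeplitz (cnj_fun a2 * \<psi> * a1) K1 K2"
    moreover from this have "f \<in> K1" by (simp add: ker_toeplitz_def)
    ultimately show "f \<in> (*) (inverse a1) ` ker_toeplitz \<psi> H1 H2"
      using iff inv by (metis image_eqI)
  next
    fix f assume "f \<in> (*) (inverse a1) ` ker_toeplitz \<psi> H1 H2"
    then obtain h where h: "h \<in> ker_toeplitz \<psi> H1 H2" "f = inverse a1 * h" by blast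
    then have "h \<in> (*) a1 ` K1" using assms(8) by (simp add: ker_toeplitz_def)
    then obtain k where "k \<in> K1" "h = a1 * k" by blast
    then show "f \<in> ker_toeplitz (cnj_fun a2 * \<psi> * a1) K1 K2" using h iff inv by simp
  qed
qed

theorem proposition3p15:
  fixes H1 H2 K1 K2 :: "circle_fun set" and \<phi> \<psi> a1 :: circle_fun
  assumes "closed_subspace H1" "closed_subspace H2" "closed_subspace K1" "closed_subspace K2"
    and "\<phi> \<in> Linf" "\<psi> \<in> Linf"
    and "a1 \<in> GLinf" "(*) a1 ` K1 = H1"
    and "ker_toeplitz \<phi> K1 K2 = (*) (inverse a1) ` ker_toeplitz \<psi> H1 H2"
  shows "\<forall>a2 \<in> GLinf. (*) a2 ` K2 = H2 \<longrightarrow>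
           cnj_fun a2 * \<psi> * a1 \<in> Linf \<and>
           ker_toeplitz \<phi> K1 K2 = ker_toeplitz (cnj_fun a2 * \<psi> * a1) K1 K2"
proof (intro ballI impI conjI)
  fix a2 assume a2: "a2 \<in> GLinf" "(*) a2 ` K2 = H2"
  then have "a2 \<in> Linf" by (simp add: GLinf_def)
  then show "cnj_fun a2 * \<psi> * a1 \<in> Linf"
    using assms(6,7) by (auto simp: GLinf_def intro: Linf_mult Linf_cnj)
  show "ker_toeplitz \<phi> K1 K2 = ker_toeplitz (cnj_fun a2 * \<psi> * a1) K1 K2"
    using ker_toeplitz_twist[OF assms(1-4,6,7) \<open>a2 \<in> Linf\<close> assms(8) a2(2)] assms(9) by simp
qed

end
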